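(* Let $n,q\ge1$ be integers and let $F$ be a graph containing a component $C$ with $|V(C)|<|E(C)|$. Then every $(q+1)$-copy of $F$ in $Q(n,2)$ must contain some $\mathbf{x}\in Q(n,2)^L$. In particular, $Q(n,2)\setminus Q(n,2)^L$ does not contain a $(q+1)$-copy of $F$, and so $$\mathrm{ex}(n,F,q)\ge \left(q^2-\left(q-\left\lceil \tfrac{q+1}{2}\right\rceil+1\right)^2\right)\binom{n}{2}.$$
   Context: All graphs are finite and simple. Let $n,q\ge 1$ be integers. For $\mathbf{x}\in\{0,1,\dots,q\}^n$ the support is $S_{\mathbf{x}}=\{i: x_i\neq 0\}$. Let $Q(n,2)=\{\mathbf{x}\in\{0,1,\dots,q\}^n: |S_{\mathbf{x}}|=2\}$; its elements are called $q$-edges, and a $q$-graph on $n$ vertices is a subset $H\subseteq Q(n,2)$. For a graph $F$ without isolated vertices and an integer $s\ge1$, a $q$-graph $H$ is an $s$-copy of $F$ if $|H|=|E(F)|$ and there is an isomorphism $\iota$ from $F$ to the graph with vertex set $\bigcup_{\mathbf{x}\in H}S_{\mathbf{x}}$ and edge set $\{S_{\mathbf{x}}:\mathbf{x}\in H\}$ such that, writing $\mathbf{x}^e$ for the unique element of $H$ with support $\iota(e)$, for all distinct $e,e'\in E(F)$ and $v\in e\cap e'$ we have $x^{e}_{\iota(v)}+x^{e'}_{\iota(v)}\ge s$. If $F$ has isolated vertices, $H\subseteq Q(n,2)$ is an $s$-copy of $F$ if $n\ge |V(F)|$ and $H$ is an $s$-copy of the subgraph of $F$ induced by its non-isolated vertices.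 A $q$-graph contains an $s$-copy of $F$ if some subset of it is an $s$-copy of $F$. $\mathrm{ex}(n,F,q)$ is the maximum of $|H|$ over all $H\subseteq Q(n,2)$ containing no $(q+1)$-copy of $F$. For $H\subseteq Q(n,2)$, $H^L=\{\mathbf{x}\in H: x_i\ge \frac{q+1}{2}\text{ for all } i\in S_{\mathbf{x}}\}$; in particular this defines $Q(n,2)^L$. *)

theory Defs
  imports Complex_Main "HOL-Library.FuncSet"
begin

(* A graph is given by its vertex set V and its set E of edges, which are two-element sets. *)

definition finite_simple_graph :: "'a set \<Rightarrow> 'a set set \<Rightarrow> bool" where
  "finite_simple_graph V E \<longleftrightarrow> finite V \<and> (\<forall>e\<in>E. e \<subseteq> V \<and> card e = 2)"

definition induced_edges :: "'a set set \<Rightarrow> 'a set \<Rightarrow> 'a set set" where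
  "induced_edges E W = {e \<in> E. e \<subseteq> W}"

definition isolated_vertices :: "'a set \<Rightarrow> 'a set set \<Rightarrow> 'a set" where
  "isolated_vertices V E = {v \<in> V. \<forall>e\<in>E. v \<notin> e}"

definition reachable :: "'a set \<Rightarrow> 'a set set \<Rightarrow> ('a \<times> 'a) set" where
  "reachable V E = {(u, v). u \<in> V \<and> v \<in> V \<and> (u, v) \<in> {(a, b). {a, b} \<in> E}\<^sup>*}"

(* Vertex sets of the connected components; the component on W has edge set induced_edges E W. *)
definition components :: "'a set \<Rightarrow> 'a set set \<Rightarrow> 'a set set" where
  "components V E = V // reachable V E"

definition graph_iso ::
  "'a set \<Rightarrow> 'a set set \<Rightarrow> 'b set \<Rightarrow> 'b set set \<Rightarrow> ('a \<Rightarrow> 'b) \<Rightarrow> bool" where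
  "graph_iso V E V' E' f \<longleftrightarrow>
     bij_betw f V V' \<and> (\<forall>u\<in>V. \<forall>v\<in>V. {u, v} \<in> E \<longleftrightarrow> {f u, f v} \<in> E')"

definition supp :: "nat \<Rightarrow> (nat \<Rightarrow> nat) \<Rightarrow> nat set" where
  "supp n x = {i \<in> {1..n}. x i \<noteq> 0}"

(* Q(n,2). Vectors in {0,...,q}^n are extensional functions on {1..n}, so that equality of
   vectors is equality of functions and cardinalities are the expected ones. *)
definition qedges :: "nat \<Rightarrow> nat \<Rightarrow> (nat \<Rightarrow> nat) set" where
  "qedges n q = {x \<in> {1..n} \<rightarrow>\<^sub>E {0..q}. card (supp n x) = 2}"

definition large_part :: "nat \<Rightarrow> nat \<Rightarrow> (nat \<Rightarrow> nat) set \<Rightarrow> (nat \<Rightarrow> nat) set" where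
  "large_part n q H = {x \<in> H. \<forall>i\<in>supp n x. real (x i) \<ge> (real q + 1) / 2}"

(* Used only when card H = card E = card (supp n ` H), which makes the element unique. *)
definition qedge_with_supp :: "nat \<Rightarrow> (nat \<Rightarrow> nat) set \<Rightarrow> nat set \<Rightarrow> nat \<Rightarrow> nat" where
  "qedge_with_supp n H S = (THE x. x \<in> H \<and> supp n x = S)"

(* s-copies of a graph without isolated vertices *)
definition is_copy_no_isolated ::
  "nat \<Rightarrow> nat \<Rightarrow> nat \<Rightarrow> 'a set \<Rightarrow> 'a set set \<Rightarrow> (nat \<Rightarrow> nat) set \<Rightarrow> bool" where
  "is_copy_no_isolated n q s V E H \<longleftrightarrow>
     H \<subseteq> qedges n q \<and> card H = card E \<and>
     (\<exists>\<iota>. graph_iso V E (\<Union>x\<in>H. supp n x) (supp n ` H) \<iota> \<and>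
        (\<forall>e\<in>E. \<forall>e'\<in>E. e \<noteq> e' \<longrightarrow>
           (\<forall>v\<in>e \<inter> e'. qedge_with_supp n H (\<iota> ` e) (\<iota> v) +
                        qedge_with_supp n H (\<iota> ` e') (\<iota> v) \<ge> s)))"

definition is_copy ::
  "nat \<Rightarrow> nat \<Rightarrow> nat \<Rightarrow> 'a set \<Rightarrow> 'a set set \<Rightarrow> (nat \<Rightarrow> nat) set \<Rightarrow> bool" where
  "is_copy n q s V E H \<longleftrightarrow>
     (if isolated_vertices V E = {} then is_copy_no_isolated n q s V E H
      else card V \<le> n \<and>
        (let W = V - isolated_vertices V E
         in is_copy_no_isolated n q s W (induced_edges E W) H))"

definition contains_copy ::
  "nat \<Rightarrow> nat \<Rightarrow> nat \<Rightarrow> 'a set \<Rightarrow> 'a set set \<Rightarrow> (nat \<Rightarrow> nat) set \<Rightarrow> bool" where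
  "contains_copy n q s V E H \<longleftrightarrow> (\<exists>H'\<subseteq>H. is_copy n q s V E H')"

(* ex(n,F,q). The maximum ranges over a finite set, which is nonempty as soon as F has an edge
   (then the empty q-graph contains no copy of F). *)
definition ex_number :: "nat \<Rightarrow> 'a set \<Rightarrow> 'a set set \<Rightarrow> nat \<Rightarrow> nat" where
  "ex_number n V E q =
     Max {card H | H. H \<subseteq> qedges n q \<and> \<not> contains_copy n q (q + 1) V E H}"

end

theory Submission
  imports Defs
begin

text \<open>
  Call a label small if it is less than \<open>s/2\<close>. In an \<open>s\<close>-copy two distinct edges that
  meet in a vertex cannot both carry small labels there, since these would add up to less than
  \<open>s\<close>. If no \<open>q\<close>-edge of the copy had both labels at least \<open>s/2\<close>, every edge would have an end
  with a small label, and choosing such an end for each edge would be an injection from edges to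
  vertices. A vertex set that spans more edges than it has vertices excludes this
  (\<open>copy_of_dense_graph_has_large_qedge\<close>); the vertex set of the component \<open>C\<close> is one.

  With \<open>s = q + 1\<close> this makes \<open>Q(n,2) \<setminus> Q(n,2)\<^sup>L\<close> free of copies of the graph, and the bound on the
  extremal number is the size of this set. Both \<open>Q(n,2)\<close> and \<open>Q(n,2)\<^sup>L\<close> consist of the vectors
  with two nonzero coordinates taken from a fixed set \<open>A\<close> of positive labels, and there are
  \<open>\<bar>A\<bar>\<^sup>2\<close> of these for each of the \<open>n choose 2\<close> supports (\<open>card_vectors_with_labels\<close>).
\<close>

lemma finite_qedges: "finite (qedges n q)"
  unfolding qedges_def by (rule finite_subset[OF _ finite_PiE[of "{1..n}" "\<lambda>_. {0..q}"]]) auto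

text \<open>
  Equal cardinalities of \<open>H\<close> and \<open>E\<close> force distinct elements of \<open>H\<close> to have distinct supports, so
  the description in \<^const>\<open>qedge_with_supp\<close> really denotes an element of \<open>H\<close>.
\<close>

lemma copy_no_isolated_labelling:
  assumes G: "finite_simple_graph V E"
    and copy: "is_copy_no_isolated n q s V E H"
  shows "\<exists>\<iota> X. (\<forall>e\<in>E. X e \<in> H \<and> supp n (X e) = \<iota> ` e) \<and>
    (\<forall>e\<in>E. \<forall>e'\<in>E. e \<noteq> e' \<longrightarrow> (\<forall>v\<in>e \<inter> e'. s \<le> X e (\<iota> v) + X e' (\<iota> v)))"
proof -
  from copy obtain \<iota> where HQ: "H \<subseteq> qedges n q" and cHE: "card H = card E"
    and iso: "graph_iso V E (\<Union>x\<in>H. supp n x) (supp n ` H) \<iota>"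
    and lab: "\<forall>e\<in>E. \<forall>e'\<in>E. e \<noteq> e' \<longrightarrow> (\<forall>v\<in>e \<inter> e'.
      qedge_with_supp n H (\<iota> ` e) (\<iota> v) + qedge_with_supp n H (\<iota> ` e') (\<iota> v) \<ge> s)"
    unfolding is_copy_no_isolated_def by blast
  from iso have bij: "bij_betw \<iota> V (\<Union>x\<in>H. supp n x)"
    and edge: "\<And>u v. u \<in> V \<Longrightarrow> v \<in> V \<Longrightarrow> {u, v} \<in> E \<longleftrightarrow> {\<iota> u, \<iota> v} \<in> supp n ` H"
    unfolding graph_iso_def by blast+
  have inj: "inj_on \<iota> V" using bij by (rule bij_betw_imp_inj_on)
  have sub: "e \<subseteq> V" "card e = 2" if "e \<in> E" for e
    using G that by (auto simp: finite_simple_graph_def)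
  have image: "\<iota> ` e \<in> supp n ` H" if "e \<in> E" for e
  proof -
    from sub[OF that] obtain u v where "e = {u, v}" "u \<in> V" "v \<in> V"
      by (auto simp: card_2_iff)
    then show ?thesis using edge[of u v] that by auto
  qed
  have "(`) \<iota> ` E = supp n ` H"
  proof
    show "(`) \<iota> ` E \<subseteq> supp n ` H" using image by blast
    show "supp n ` H \<subseteq> (`) \<iota> ` E"
    proof
      fix S assume S: "S \<in> supp n ` H"
      then have "card S = 2" using HQ by (auto simp: qedges_def)
      then obtain a b where ab: "S = {a, b}" by (auto simp: card_2_iff)
      have "S \<subseteq> \<iota> ` V" using S bij by (auto simp: bij_betw_def)
      then obtain u v where uv: "u \<in> V" "v \<in> V" "a = \<iota> u" "b = \<iota> v" using ab by auto
      then have "{u, v} \<in> E" using edge S ab by auto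
      moreover have "S = \<iota> ` {u, v}" using ab uv by auto
      ultimately show "S \<in> (`) \<iota> ` E" by blast
    qed
  qed
  moreover have "inj_on ((`) \<iota>) E"
    using sub(1) inj by (intro inj_onI) (metis inj_on_image_eq_iff)
  ultimately have "card (supp n ` H) = card H" using cHE by (metis card_image)
  moreover have "finite H" using HQ finite_qedges by (rule finite_subset)
  ultimately have injH: "inj_on (supp n) H" by (simp add: eq_card_imp_inj_on)
  have mem: "qedge_with_supp n H S \<in> H \<and> supp n (qedge_with_supp n H S) = S"
    if S: "S \<in> supp n ` H" for S
  proof -
    from S have "\<exists>!x. x \<in> H \<and> supp n x = S" using injH by (auto dest: inj_onD)
    then show ?thesis unfolding qedge_with_supp_def by (rule theI')
  qed
  show ?thesis
    by (rule exI[of _ \<iota>], rule exI[of _ "\<lambda>e. qedge_with_supp n H (\<iota> ` e)"])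
      (intro conjI ballI lab mem image)
qed

text \<open>
  Edges avoid isolated vertices, so deleting those vertices leaves the edge set unchanged and the
  labelling carries over to graphs that have them.
\<close>

lemma copy_labelling:
  assumes G: "finite_simple_graph V E" and copy: "is_copy n q s V E H"
  shows "\<exists>\<iota> X. (\<forall>e\<in>E. X e \<in> H \<and> supp n (X e) = \<iota> ` e) \<and>
    (\<forall>e\<in>E. \<forall>e'\<in>E. e \<noteq> e' \<longrightarrow> (\<forall>v\<in>e \<inter> e'. s \<le> X e (\<iota> v) + X e' (\<iota> v)))"
proof -
  define W where "W = V - isolated_vertices V E"
  have EV: "e \<subseteq> V" if "e \<in> E" for e using G that by (auto simp: finite_simple_graph_def)
  then have EW: "e \<subseteq> W" if "e \<in> E" for e
    using that by (auto simp: W_def isolated_vertices_def)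
  then have ind: "induced_edges E W = E" by (auto simp: induced_edges_def)
  have GW: "finite_simple_graph W E"
    using G EW by (auto simp: finite_simple_graph_def W_def)
  have copyW: "is_copy_no_isolated n q s W E H"
    using copy ind by (auto simp: is_copy_def W_def Let_def split: if_splits)
  from copy_no_isolated_labelling[OF GW copyW] show ?thesis .
qed

text \<open>
  Otherwise each edge spanned by \<open>W\<close> has an end whose label is less than \<open>s/2\<close>. No vertex serves
  two edges in this way, so \<open>W\<close> would have at least as many vertices as edges.
\<close>

lemma copy_of_dense_graph_has_large_qedge:
  assumes G: "finite_simple_graph V E" and copy: "is_copy n q s V E H"
    and "finite W" and dense: "card W < card (induced_edges E W)"
  shows "\<exists>x\<in>H. \<forall>i\<in>supp n x. s \<le> 2 * x i"
proof (rule ccontr)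
  assume small: "\<not> ?thesis"
  obtain \<iota> X where X: "\<forall>e\<in>E. X e \<in> H \<and> supp n (X e) = \<iota> ` e"
    and lab: "\<forall>e\<in>E. \<forall>e'\<in>E. e \<noteq> e' \<longrightarrow> (\<forall>v\<in>e \<inter> e'. s \<le> X e (\<iota> v) + X e' (\<iota> v))"
    using copy_labelling[OF G copy] by (elim exE conjE)
  have "\<forall>e\<in>E. \<exists>v. v \<in> e \<and> 2 * X e (\<iota> v) < s"
  proof
    fix e assume "e \<in> E"
    with X have "X e \<in> H" "supp n (X e) = \<iota> ` e" by blast+
    with small have "\<not> (\<forall>i\<in>\<iota> ` e. s \<le> 2 * X e i)" by metis
    then show "\<exists>v. v \<in> e \<and> 2 * X e (\<iota> v) < s" by (auto simp: not_le)
  qed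
  from bchoice[OF this] obtain g
    where "\<forall>e\<in>E. g e \<in> e \<and> 2 * X e (\<iota> (g e)) < s" ..
  then have g: "g e \<in> e \<and> 2 * X e (\<iota> (g e)) < s" if "e \<in> E" for e using that by blast
  have "inj_on g (induced_edges E W)"
  proof (rule inj_onI, rule ccontr)
    fix e e' assume ee: "e \<in> induced_edges E W" "e' \<in> induced_edges E W" "g e = g e'" "e \<noteq> e'"
    then have E: "e \<in> E" "e' \<in> E" by (auto simp: induced_edges_def)
    then have "g e \<in> e \<inter> e'" using g[OF E(1)] g[OF E(2)] ee(3) by simp
    then have "s \<le> X e (\<iota> (g e)) + X e' (\<iota> (g e))" using lab E ee(4) by blast
    then show False using g[OF E(1)] g[OF E(2)] ee(3) by auto
  qed
  moreover have "g ` induced_edges E W \<subseteq> W" using g by (auto simp: induced_edges_def)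
  ultimately have "card (induced_edges E W) \<le> card W"
    using \<open>finite W\<close> by (rule card_inj_on_le)
  then show False using dense by simp
qed

lemma component_subset: "C \<in> components V E \<Longrightarrow> C \<subseteq> V"
  by (auto simp: components_def reachable_def quotient_def)

lemma finite_component:
  assumes "finite_simple_graph V E" "C \<in> components V E"
  shows "finite C"
  using assms component_subset finite_subset by (metis finite_simple_graph_def)

text \<open>
  A vector whose support is a given set \<open>S\<close> is a choice of a label from \<open>A\<close> at each point of \<open>S\<close>
  and of the label 0 elsewhere, which makes the vectors with that support a product set.
\<close>

lemma card_vectors_with_labels:
  assumes A: "A \<subseteq> {1..q}"
  shows "card {x \<in> qedges n q. \<forall>i\<in>supp n x. x i \<in> A} = (card A)\<^sup>2 * (n choose 2)"
proof -
  define T where "T = {S. S \<subseteq> {1..n} \<and> card S = 2}"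
  define P where "P S = ({1..n} \<rightarrow>\<^sub>E {0..q}) \<inter> (\<Pi>\<^sub>E i\<in>{1..n}. if i \<in> S then A else {0})" for S
  have P_eq: "P S = (\<Pi>\<^sub>E i\<in>{1..n}. if i \<in> S then A else {0})" for S
    unfolding P_def using A by (fastforce simp: PiE_iff split: if_splits)
  have supp_P: "supp n x = S" if "x \<in> P S" "S \<in> T" for x S
    using that A by (fastforce simp: P_def T_def supp_def PiE_iff split: if_splits)
  have "{x \<in> qedges n q. \<forall>i\<in>supp n x. x i \<in> A} = (\<Union>S\<in>T. P S)"
  proof (intro equalityI subsetI)
    fix x assume "x \<in> {x \<in> qedges n q. \<forall>i\<in>supp n x. x i \<in> A}"
    then have "supp n x \<in> T" "x \<in> P (supp n x)"
      by (auto simp: T_def P_def qedges_def supp_def PiE_iff)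
    then show "x \<in> (\<Union>S\<in>T. P S)" by blast
  next
    fix x assume "x \<in> (\<Union>S\<in>T. P S)"
    then obtain S where S: "S \<in> T" "x \<in> P S" by blast
    then have "supp n x = S" by (intro supp_P)
    moreover have "x i \<in> A" if "i \<in> S" for i
      using S that by (force simp: P_def T_def PiE_iff)
    ultimately show "x \<in> {x \<in> qedges n q. \<forall>i\<in>supp n x. x i \<in> A}"
      using S by (auto simp: qedges_def P_def T_def)
  qed
  moreover have "card (\<Union>S\<in>T. P S) = (\<Sum>S\<in>T. card (P S))"
  proof (rule card_UN_disjoint)
    show "finite T" unfolding T_def by auto
    show "\<forall>S\<in>T. finite (P S)" unfolding P_def by (auto intro: finite_PiE)
    show "\<forall>S\<in>T. \<forall>S'\<in>T. S \<noteq> S' \<longrightarrow> P S \<inter> P S' = {}" using supp_P by blast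
  qed
  moreover have "card (P S) = (card A)\<^sup>2" if "S \<in> T" for S
  proof -
    have "card (P S) = (\<Prod>i\<in>{1..n}. if i \<in> S then card A else 1)"
      unfolding P_eq by (subst card_PiE) (auto intro!: prod.cong)
    also have "\<dots> = (\<Prod>i\<in>{1..n} \<inter> S. card A)" by (subst prod.inter_restrict) auto
    also have "{1..n} \<inter> S = S" using that by (auto simp: T_def)
    finally show ?thesis using that by (simp add: T_def)
  qed
  moreover have "card T = n choose 2" unfolding T_def using n_subsets[of "{1..n}" 2] by simp
  ultimately show ?thesis by simp
qed

lemma card_qedges: "card (qedges n q) = q\<^sup>2 * (n choose 2)"
proof -
  have "qedges n q = {x \<in> qedges n q. \<forall>i\<in>supp n x. x i \<in> {1..q}}"
    by (auto simp: qedges_def supp_def PiE_iff)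
  then show ?thesis using card_vectors_with_labels[of "{1..q}" q n] by simp
qed

lemma card_large_part_qedges:
  "int (card (large_part n q (qedges n q))) =
     (int q - \<lceil>(real q + 1) / 2\<rceil> + 1)\<^sup>2 * int (n choose 2)"
proof -
  define A where "A = {nat \<lceil>(real q + 1) / 2\<rceil>..q}"
  have "large_part n q (qedges n q) = {x \<in> qedges n q. \<forall>i\<in>supp n x. x i \<in> A}"
    by (auto simp: large_part_def A_def qedges_def supp_def PiE_iff nat_le_iff ceiling_le_iff)
  moreover have "1 \<le> \<lceil>(real q + 1) / 2\<rceil>" by (simp add: le_ceiling_iff)
  then have "1 \<le> nat \<lceil>(real q + 1) / 2\<rceil>" by linarith
  then have "A \<subseteq> {1..q}" unfolding A_def by (simp only: atLeastatMost_subset_iff) simp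
  moreover have "\<lceil>(real q + 1) / 2\<rceil> \<le> int q + 1" "0 \<le> \<lceil>(real q + 1) / 2\<rceil>"
    by (simp_all add: ceiling_le_iff)
  then have "int (card A) = int q - \<lceil>(real q + 1) / 2\<rceil> + 1"
    by (simp add: A_def of_nat_diff nat_le_iff)
  ultimately show ?thesis using card_vectors_with_labels[of A q n] by simp
qed

theorem proposition1p8:
  fixes n q :: nat and V C :: "'a set" and E :: "'a set set"
  assumes "n \<ge> 1" and "q \<ge> 1"
    and "finite_simple_graph V E"
    and "C \<in> components V E"
    and "card C < card (induced_edges E C)"
  shows "(\<forall>H. H \<subseteq> qedges n q \<and> is_copy n q (q + 1) V E H \<longrightarrow>
            (\<exists>x\<in>H. x \<in> large_part n q (qedges n q))) \<and>
         \<not> contains_copy n q (q + 1) V E (qedges n q - large_part n q (qedges n q)) \<and>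
         int (ex_number n V E q) \<ge>
           ((int q)\<^sup>2 - (int q - \<lceil>(real q + 1) / 2\<rceil> + 1)\<^sup>2) * int (n choose 2)"
proof -
  let ?Q = "qedges n q" and ?L = "large_part n q (qedges n q)"
  have large: "\<exists>x\<in>H. x \<in> ?L" if H: "H \<subseteq> ?Q" "is_copy n q (q + 1) V E H" for H
  proof -
    from copy_of_dense_graph_has_large_qedge[OF assms(3) H(2) finite_component[OF assms(3,4)] assms(5)]
    obtain x where x: "x \<in> H" "\<forall>i\<in>supp n x. q + 1 \<le> 2 * x i" by blast
    have "real (x i) \<ge> (real q + 1) / 2" if "i \<in> supp n x" for i
      using x(2) that by fastforce
    then show ?thesis using x(1) H(1) by (auto simp: large_part_def)
  qed
  then have free: "\<not> contains_copy n q (q + 1) V E (?Q - ?L)"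
    unfolding contains_copy_def by blast
  let ?sizes = "{card H | H. H \<subseteq> ?Q \<and> \<not> contains_copy n q (q + 1) V E H}"
  have "?sizes \<subseteq> card ` Pow ?Q" by blast
  then have "finite ?sizes" by (rule finite_subset) (simp add: finite_qedges)
  moreover have "card (?Q - ?L) \<in> ?sizes" using free by blast
  ultimately have "card (?Q - ?L) \<le> ex_number n V E q"
    unfolding ex_number_def by (rule Max_ge)
  moreover have LQ: "?L \<subseteq> ?Q" by (auto simp: large_part_def)
  then have "int (card (?Q - ?L)) = int (card ?Q) - int (card ?L)"
    using finite_qedges finite_subset[OF LQ] card_mono[OF finite_qedges LQ]
    by (simp add: card_Diff_subset of_nat_diff)
  then have "int (card (?Q - ?L)) =
      ((int q)\<^sup>2 - (int q - \<lceil>(real q + 1) / 2\<rceil> + 1)\<^sup>2) * int (n choose 2)"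
    by (simp only: card_qedges card_large_part_qedges) (simp add: algebra_simps)
  ultimately show ?thesis using large free by auto
qed

end
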